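(* Let $\rho$ be a positive function defined on $(\mathbb R^{n+1}_+,g_+=\frac1{y^2}|dz|^2)$ with the following properties: (1) $\rho\in C^2(\overline{\mathbb R}{}^{n+1}_+)$; (2) $\rho(x,0)=0$ and $\partial_y\rho(x,0)=\lim_{y\to0}\frac{\rho(x,y)}{y}=1$ for all $x\in\mathbb R^n$, or equivalently, the induced boundary metric on $\mathbb R^n$ of the compactified manifold $(\overline{\mathbb R}{}^{n+1}_+,g^*=\rho^2g_+)$ is the Euclidean metric; (3) the scalar curvature $R^*$ of the compactified metric $g^*$ is non-negative; (4) $|\nabla^*\rho|\le1$. Then $\rho\equiv y$, or equivalently, $g^*\equiv|dz|^2$.
   Context: $\mathbb R^{n+1}_+=\{z=(x,y):x\in\mathbb R^n,\ y>0\}$, $\overline{\mathbb R}{}^{n+1}_+=\{y\ge0\}$, and $\mathbb R^n$ is identified with $\{y=0\}$. $\nabla^*$ is the covariant derivative of $g^*=\rho^2g_+=\frac{\rho^2}{y^2}|dz|^2$, and $|\nabla^*\rho|$ is the norm with respect to $g^*$; thus $|\nabla^*\rho|=\frac y\rho|\nabla\rho|$ with the Euclidean gradient on the right. *)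

theory Defs
  imports "HOL-Analysis.Analysis"
begin

section \<open>Curvature of a Riemannian metric in standard coordinates\<close>

text \<open>A metric on a region of a Euclidean space is a function \<open>g\<close>, where \<open>g z u v\<close> is the inner
  product of the tangent vectors \<open>u\<close> and \<open>v\<close> at \<open>z\<close>. The coordinate fields are the elements of
  \<open>Basis\<close>, which also serve as tensor indices.\<close>

type_synonym 'a metric = "'a \<Rightarrow> 'a \<Rightarrow> 'a \<Rightarrow> real"

definition partial_deriv :: "'a::euclidean_space \<Rightarrow> ('a \<Rightarrow> real) \<Rightarrow> 'a \<Rightarrow> real" where
  "partial_deriv i f z = deriv (\<lambda>t. f (z + t *\<^sub>R i)) 0"

text \<open>\<open>inverse_metric g z i j\<close> is the entry $g^{ij}$ of the inverse matrix: the linear map being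
  inverted is the one whose matrix is $(g_{ij})$.\<close>

definition inverse_metric :: "'a::euclidean_space metric \<Rightarrow> 'a metric" where
  "inverse_metric g z i j = inv (\<lambda>u. \<Sum>k\<in>Basis. g z u k *\<^sub>R k) i \<bullet> j"

text \<open>\<open>christoffel g k i j\<close> is $\Gamma^k_{ij}$.\<close>

definition christoffel :: "'a::euclidean_space metric \<Rightarrow> 'a \<Rightarrow> 'a \<Rightarrow> 'a \<Rightarrow> 'a \<Rightarrow> real" where
  "christoffel g k i j z = 1/2 * (\<Sum>l\<in>Basis. inverse_metric g z k l *
     (partial_deriv i (\<lambda>w. g w j l) z + partial_deriv j (\<lambda>w. g w i l) z
       - partial_deriv l (\<lambda>w. g w i j) z))"

text \<open>\<open>riemann g l i j k\<close> is the component along \<open>l\<close> of $R(\partial_i,\partial_j)\partial_k$, where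
  $R(X,Y)Z=\nabla_X\nabla_YZ-\nabla_Y\nabla_XZ-\nabla_{[X,Y]}Z$. With the contraction chosen below,
  round spheres have positive Ricci and scalar curvature.\<close>

definition riemann :: "'a::euclidean_space metric \<Rightarrow> 'a \<Rightarrow> 'a \<Rightarrow> 'a \<Rightarrow> 'a \<Rightarrow> 'a \<Rightarrow> real" where
  "riemann g l i j k z =
     partial_deriv i (christoffel g l j k) z - partial_deriv j (christoffel g l i k) z
     + (\<Sum>m\<in>Basis. christoffel g l i m z * christoffel g m j k z
                 - christoffel g l j m z * christoffel g m i k z)"

definition ricci :: "'a::euclidean_space metric \<Rightarrow> 'a \<Rightarrow> 'a \<Rightarrow> 'a \<Rightarrow> real" where
  "ricci g j k z = (\<Sum>i\<in>Basis. riemann g i i j k z)"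

definition scalar_curvature :: "'a::euclidean_space metric \<Rightarrow> 'a \<Rightarrow> real" where
  "scalar_curvature g z =
     (\<Sum>j\<in>Basis. \<Sum>k\<in>Basis. inverse_metric g z j k * ricci g j k z)"

definition metric_gradient :: "'a::euclidean_space metric \<Rightarrow> ('a \<Rightarrow> real) \<Rightarrow> 'a \<Rightarrow> 'a" where
  "metric_gradient g f z =
     (\<Sum>i\<in>Basis. (\<Sum>j\<in>Basis. inverse_metric g z i j * partial_deriv j f z) *\<^sub>R i)"

definition metric_norm :: "'a metric \<Rightarrow> 'a \<Rightarrow> 'a \<Rightarrow> real" where
  "metric_norm g z u = sqrt (g z u u)"


section \<open>The half-space and its conformal compactifications\<close>

text \<open>Points are pairs \<open>(x, y)\<close> with \<open>x :: real ^ 'n\<close>, so the dimension is \<open>CARD('n) + 1\<close>.\<close>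

definition half_space :: "((real ^ 'n) \<times> real) set" where
  "half_space = {z. 0 < snd z}"

definition closed_half_space :: "((real ^ 'n) \<times> real) set" where
  "closed_half_space = {z. 0 \<le> snd z}"

definition hyperbolic_metric :: "((real ^ 'n) \<times> real) metric" where
  "hyperbolic_metric z u v = (u \<bullet> v) / (snd z)\<^sup>2"

definition compactified_metric ::
    "((real ^ 'n) \<times> real \<Rightarrow> real) \<Rightarrow> ((real ^ 'n) \<times> real) metric" where
  "compactified_metric \<rho> z u v = (\<rho> z)\<^sup>2 * hyperbolic_metric z u v"

text \<open>Derivatives are taken within \<open>S\<close>, hence one-sided at the boundary. When \<open>S\<close> is the closed
  half-space this says that the derivatives up to order two in the interior extend continuously
  to the boundary.\<close>

definition C2_on :: "('a::euclidean_space \<Rightarrow> real) \<Rightarrow> 'a set \<Rightarrow> bool" where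
  "C2_on f S \<longleftrightarrow>
     (\<exists>(f' :: 'a \<Rightarrow> 'a \<Rightarrow>\<^sub>L real) (f'' :: 'a \<Rightarrow> 'a \<Rightarrow>\<^sub>L 'a \<Rightarrow>\<^sub>L real).
        (\<forall>z\<in>S. (f has_derivative blinfun_apply (f' z)) (at z within S)) \<and>
        (\<forall>z\<in>S. (f' has_derivative blinfun_apply (f'' z)) (at z within S)) \<and>
        continuous_on S f'')"

definition boundary_normalized :: "((real ^ 'n) \<times> real \<Rightarrow> real) \<Rightarrow> bool" where
  "boundary_normalized \<rho> \<longleftrightarrow>
     (\<forall>x. \<rho> (x, 0) = 0 \<and>
          ((\<lambda>y. \<rho> (x, y)) has_real_derivative 1) (at 0 within {0..}) \<and>
          ((\<lambda>y. \<rho> (x, y) / y) \<longlongrightarrow> 1) (at_right 0))"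

text \<open>The formula for the compactified metric has no meaning at \<open>y = 0\<close>; its value there is the
  limit from the interior, restricted to vectors tangent to the boundary.\<close>

definition boundary_metric_euclidean :: "((real ^ 'n) \<times> real \<Rightarrow> real) \<Rightarrow> bool" where
  "boundary_metric_euclidean \<rho> \<longleftrightarrow>
     (\<forall>x u v. ((\<lambda>z. compactified_metric \<rho> z (u, 0) (v, 0)) \<longlongrightarrow> u \<bullet> v)
                (at (x, 0) within half_space))"

end

theory Submission
  imports Defs "HOL-Real_Asymp.Real_Asymp"
begin

text \<open>Put \<open>\<phi> = ln (\<rho> / y)\<close>, so that \<open>g\<^sup>* = exp (2 \<phi>) |dz|\<^sup>2\<close>. The curvature hypothesis
  gives \<open>2 \<Delta>\<phi> + (n - 1) |\<nabla>\<phi>|\<^sup>2 \<le> 0\<close>, hence \<open>-\<phi>\<close> is subharmonic, and it vanishes on the boundary.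
  The gradient hypothesis reads \<open>|\<nabla> ln \<rho>| \<le> 1 / y\<close>. Therefore \<open>\<phi>\<close> is nonincreasing in \<open>y\<close>, so
  \<open>\<phi> \<le> 0\<close>. Also \<open>y \<rho>\<close> is nondecreasing in \<open>y\<close> and \<open>ln \<rho>\<close> varies by at most \<open>1\<close> over a
  horizontal distance \<open>R\<close> at height \<open>R\<close>; following a vertical segment up to height \<open>R\<close> and then a
  horizontal one bounds \<open>-\<phi>\<close> by \<open>O(ln R)\<close> on a box of size \<open>R\<close>. A subharmonic function of
  sublinear growth on the half-space that vanishes on the boundary is nonpositive
  (Phragmen--Lindelof), so \<open>\<phi> \<ge> 0\<close> as well.\<close>

section \<open>Conformally flat metrics\<close>

text \<open>The formulas for the metric and the Christoffel symbols hold only on an open set;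
  differentiation at one of its points depends on nothing else.\<close>

lemma partial_deriv_eqI_on_open:
  assumes "open S" "z \<in> S" and "\<And>w. w \<in> S \<Longrightarrow> f w = h w"
    and "((\<lambda>t. h (z + t *\<^sub>R i)) has_real_derivative D) (at 0)"
  shows "partial_deriv i f z = D"
proof -
  have "continuous_on UNIV (\<lambda>t::real. z + t *\<^sub>R i)"
    by (intro continuous_intros)
  then have "open ((\<lambda>t::real. z + t *\<^sub>R i) -` S)"
    using assms(1) by (simp add: continuous_on_open_vimage)
  then have "((\<lambda>t. f (z + t *\<^sub>R i)) has_real_derivative D) (at 0)"
    by (rule has_field_derivative_transform_within_open[OF assms(4)]) (use assms(2,3) in auto)
  then show ?thesis
    unfolding partial_deriv_def by (rule DERIV_imp_deriv)
qed

lemma inverse_metric_conformal: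
  fixes g :: "'a::euclidean_space metric"
  assumes "\<And>u v. g z u v = c * (u \<bullet> v)" and "c \<noteq> 0"
  shows "inverse_metric g z i j = (i \<bullet> j) / c"
proof -
  have "(\<lambda>u. \<Sum>k\<in>Basis. g z u k *\<^sub>R k) = (\<lambda>u. c *\<^sub>R u)"
    by (simp add: assms(1) euclidean_representation flip: scaleR_scaleR scaleR_sum_right)
  moreover have "inv (\<lambda>u::'a. c *\<^sub>R u) = (\<lambda>u. u /\<^sub>R c)"
    using assms(2) by (intro inv_equality) auto
  ultimately show ?thesis
    by (simp add: inverse_metric_def divide_inverse mult.commute)
qed

text \<open>\<open>P i\<close> and \<open>Q i j\<close> stand for the first and second partial
  derivatives of \<open>\<phi>\<close>; the first index of \<open>Q\<close> is the direction of the
  last differentiation. Derivatives are taken along coordinate lines, as in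
  \<open>partial_deriv\<close>.\<close>

locale conformally_flat =
  fixes S :: "'a::euclidean_space set" and g :: "'a metric" and \<phi> :: "'a \<Rightarrow> real"
    and P :: "'a \<Rightarrow> 'a \<Rightarrow> real" and Q :: "'a \<Rightarrow> 'a \<Rightarrow> 'a \<Rightarrow> real"
  assumes open_S: "open S"
    and metric: "w \<in> S \<Longrightarrow> g w u v = exp (2 * \<phi> w) * (u \<bullet> v)"
    and partial: "w \<in> S \<Longrightarrow> i \<in> Basis \<Longrightarrow>
      ((\<lambda>t. \<phi> (w + t *\<^sub>R i)) has_real_derivative P i w) (at 0)"
    and partial2: "w \<in> S \<Longrightarrow> i \<in> Basis \<Longrightarrow> j \<in> Basis \<Longrightarrow>
      ((\<lambda>t. P j (w + t *\<^sub>R i)) has_real_derivative Q i j w) (at 0)"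
begin

lemma inverse: "w \<in> S \<Longrightarrow> inverse_metric g w i j = exp (- 2 * \<phi> w) * (i \<bullet> j)"
  by (subst inverse_metric_conformal[where c = "exp (2 * \<phi> w)"])
    (auto simp: metric exp_minus divide_inverse)

lemma partial_deriv_metric:
  assumes "w \<in> S" "i \<in> Basis"
  shows "partial_deriv i (\<lambda>w. g w u v) w = 2 * exp (2 * \<phi> w) * P i w * (u \<bullet> v)"
  by (rule partial_deriv_eqI_on_open[OF open_S assms(1) metric], assumption)
    (use partial[OF assms] in \<open>auto intro!: derivative_eq_intros\<close>)

text \<open>The factor \<open>exp (2 * \<phi> w)\<close> in the derivatives of the metric cancels
  against the inverse metric, which leaves Kronecker deltas times first derivatives.\<close>

lemma christoffel:
  assumes "w \<in> S" "k \<in> Basis" "i \<in> Basis" "j \<in> Basis"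
  shows "christoffel g k i j w = (j \<bullet> k) * P i w + (i \<bullet> k) * P j w - (i \<bullet> j) * P k w"
proof -
  have "christoffel g k i j w = 1/2 * (\<Sum>l\<in>Basis. (k \<bullet> l) *
      (2 * P i w * (j \<bullet> l) + 2 * P j w * (i \<bullet> l) - 2 * P l w * (i \<bullet> j)))"
    unfolding christoffel_def using assms
    by (intro arg_cong[where f = "(*) (1/2)"] sum.cong)
      (simp_all add: inverse partial_deriv_metric exp_minus field_simps)
  also have "\<dots> = (\<Sum>l\<in>Basis. if k = l then P i w * (j \<bullet> l) + P j w * (i \<bullet> l) - P l w * (i \<bullet> j) else 0)"
    unfolding sum_distrib_left using assms
    by (intro sum.cong) (auto simp: inner_Basis)
  finally show ?thesis
    using assms by (simp add: mult.commute)
qed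

lemma partial_deriv_christoffel:
  assumes "w \<in> S" "k \<in> Basis" "i \<in> Basis" "j \<in> Basis" "l \<in> Basis"
  shows "partial_deriv l (christoffel g k i j) w
    = (j \<bullet> k) * Q l i w + (i \<bullet> k) * Q l j w - (i \<bullet> j) * Q l k w"
  by (rule partial_deriv_eqI_on_open[OF open_S assms(1) christoffel])
    (use assms in \<open>auto intro!: derivative_eq_intros partial2\<close>)

text \<open>The inverse metric is diagonal, so the scalar curvature sees only these entries, and in
  them the Kronecker deltas remove every mixed second derivative.\<close>

lemma ricci_diag:
  assumes w: "w \<in> S" and j: "j \<in> Basis"
  shows "ricci g j j w = (2 - real DIM('a)) * Q j j w - (\<Sum>i\<in>Basis. Q i i w)
    + (real DIM('a) - 2) * ((P j w)\<^sup>2 - (\<Sum>m\<in>Basis. (P m w)\<^sup>2))"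
proof -
  have first: "(\<Sum>i\<in>Basis. partial_deriv i (christoffel g i j j) w - partial_deriv j (christoffel g i i j) w)
     = (\<Sum>i\<in>Basis. (if i = j then 2 * Q j j w else 0) - Q i i w - Q j j w)"
    using w j by (intro sum.cong) (auto simp: partial_deriv_christoffel inner_Basis)
  \<comment> \<open>With A = delta_im P_j and B = delta_ij P_m - delta_jm P_i, the second product is
    (A + B)(A - B). The last conditional is the cross term of B^2, present only for i = j =
    m.\<close>
  have *: "(\<Sum>m\<in>Basis. christoffel g i i m w * christoffel g m j j w
            - christoffel g i j m w * christoffel g m i j w)
     = (\<Sum>m\<in>Basis. (if m = j then 2 * (P j w)\<^sup>2 else 0) - (P m w)\<^sup>2
        - (if m = i then (P j w)\<^sup>2 else 0) + (if i = j then (P m w)\<^sup>2 else 0)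
        + (if m = j then (P i w)\<^sup>2 else 0) - (if m = j then if i = j then 2 * (P j w)\<^sup>2 else 0 else 0))"
    if i: "i \<in> Basis" for i
    using w j i by (intro sum.cong) (auto simp: christoffel inner_Basis power2_eq_square algebra_simps)
  have "(\<Sum>i\<in>Basis. \<Sum>m\<in>Basis. christoffel g i i m w * christoffel g m j j w
            - christoffel g i j m w * christoffel g m i j w)
      = (\<Sum>i\<in>Basis. 2 * (P j w)\<^sup>2 - (\<Sum>m\<in>Basis. (P m w)\<^sup>2) - (P j w)\<^sup>2 
          + (if i = j then (\<Sum>m\<in>Basis. (P m w)\<^sup>2) else 0) + (P i w)\<^sup>2
          - (if i = j then 2 * (P j w)\<^sup>2 else 0))"
    by (intro sum.cong refl, subst *) (use j in \<open>auto simp: sum.distrib sum_subtractf\<close>)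
  then show ?thesis
    using first j unfolding ricci_def riemann_def
    by (simp add: sum.distrib sum_subtractf algebra_simps)
qed

text \<open>This is the conformal change formula over a flat background. In the sum over j, with N
  the dimension, the Laplacian collects 2 - N - N = -2 (N - 1) and the squared gradient (N - 2)(1 -
  N).\<close>

lemma scalar_curvature:
  assumes w: "w \<in> S"
  shows "scalar_curvature g w = - exp (- 2 * \<phi> w) * (real DIM('a) - 1) *
    (2 * (\<Sum>i\<in>Basis. Q i i w) + (real DIM('a) - 2) * (\<Sum>i\<in>Basis. (P i w)\<^sup>2))"
proof -
  have "scalar_curvature g w = (\<Sum>j\<in>Basis. \<Sum>k\<in>Basis. if k = j then exp (- 2 * \<phi> w) * ricci g j j w else 0)"
    unfolding scalar_curvature_def using w
    by (intro sum.cong) (auto simp: inverse inner_Basis)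
  also have "\<dots> = exp (- 2 * \<phi> w) * (\<Sum>j\<in>Basis. ricci g j j w)"
    by (simp add: sum_distrib_left)
  also have "(\<Sum>j\<in>Basis. ricci g j j w) = - (real DIM('a) - 1) *
    (2 * (\<Sum>i\<in>Basis. Q i i w) + (real DIM('a) - 2) * (\<Sum>i\<in>Basis. (P i w)\<^sup>2))"
    using w by (simp add: ricci_diag sum.distrib sum_subtractf algebra_simps flip: sum_distrib_left)
  finally show ?thesis by (simp add: algebra_simps)
qed

text \<open>Raising the index costs the factor \<open>exp (- 2 * \<phi> w)\<close>, and measuring
  the resulting vector in \<open>g\<close> gives back \<open>exp (\<phi> w)\<close>.\<close>

lemma norm_metric_gradient:
  assumes w: "w \<in> S"
  shows "metric_norm g w (metric_gradient g f w)
    = exp (- \<phi> w) * norm (\<Sum>i\<in>Basis. partial_deriv i f w *\<^sub>R i)"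
proof -
  have "metric_gradient g f w = (\<Sum>i\<in>Basis. exp (- 2 * \<phi> w) *\<^sub>R partial_deriv i f w *\<^sub>R i)"
    unfolding metric_gradient_def using w
    by (intro sum.cong) (auto simp: inverse inner_Basis if_distrib if_distribR cong: if_cong)
  then have *: "metric_gradient g f w = exp (- 2 * \<phi> w) *\<^sub>R (\<Sum>i\<in>Basis. partial_deriv i f w *\<^sub>R i)"
    by (simp add: scaleR_sum_right)
  have "metric_norm g w v = exp (\<phi> w) * norm v" for v
    by (simp add: metric_norm_def metric[OF w] norm_eq_sqrt_inner real_sqrt_mult exp_double)
  then show ?thesis
    by (simp add: * flip: mult.assoc exp_add)
qed

end

section \<open>Subharmonic functions on the half-space\<close>

text \<open>At the maximum the first derivative vanishes. If \<open>D\<close> were positive, the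
  first derivative would be positive just to the right of 0, and the mean value theorem would make
  \<open>h\<close> exceed \<open>h 0\<close> there.\<close>

lemma second_derivative_nonpos_at_local_max:
  fixes h :: "real \<Rightarrow> real"
  assumes d: "0 < d" and max: "\<And>t. \<bar>t\<bar> < d \<Longrightarrow> h t \<le> h 0"
    and h': "\<And>t. \<bar>t\<bar> < d \<Longrightarrow> (h has_real_derivative h' t) (at t)"
    and D: "(h' has_real_derivative D) (at 0)"
  shows "D \<le> 0"
proof (rule ccontr)
  assume "\<not> D \<le> 0"
  then obtain e where e: "e > 0" "\<And>t. 0 < t \<Longrightarrow> t < e \<Longrightarrow> h' 0 < h' t"
    using DERIV_pos_inc_right[OF D] by auto
  have "h' 0 = 0"
    using DERIV_local_max[OF h'[of 0] d] max d by auto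
  define t where "t = min d e / 2"
  have t: "0 < t" "t < d" "t < e"
    using d e(1) by (auto simp: t_def)
  obtain s where s: "0 < s" "s < t" "h t - h 0 = (t - 0) * h' s"
    using MVT2[OF t(1), of h h'] h' t by force
  then have "h t > h 0"
    using e(2)[of s] t \<open>h' 0 = 0\<close> by (smt (verit) mult_pos_pos)
  then show False
    using max[of t] t by simp
qed

text \<open>At a maximum point in \<open>U\<close> no second derivative along a coordinate line can
  be positive, against the strict sign of their sum. So the maximum is attained on
  \<open>K - U\<close>.\<close>

lemma max_principle:
  fixes u :: "'a::euclidean_space \<Rightarrow> real"
  assumes "compact K" "continuous_on K u" "open U"
    and P: "\<And>z i. z \<in> U \<Longrightarrow> i \<in> Basis \<Longrightarrow>
      ((\<lambda>t. u (z + t *\<^sub>R i)) has_real_derivative P i z) (at 0)"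
    and Q: "\<And>z i. z \<in> U \<Longrightarrow> i \<in> Basis \<Longrightarrow>
      ((\<lambda>t. P i (z + t *\<^sub>R i)) has_real_derivative Q i z) (at 0)"
    and pos: "\<And>z. z \<in> U \<Longrightarrow> (\<Sum>i\<in>Basis. Q i z) > 0"
    and "U \<subseteq> K" and bdry: "\<And>z. z \<in> K - U \<Longrightarrow> u z \<le> 0"
    and "z \<in> K"
  shows "u z \<le> 0"
proof -
  obtain m where m: "m \<in> K" "\<And>w. w \<in> K \<Longrightarrow> u w \<le> u m"
    using continuous_attains_sup[OF assms(1) _ assms(2)] \<open>z \<in> K\<close> by blast
  have "m \<notin> U"
  proof
    assume "m \<in> U"
    then obtain d where d: "d > 0" "ball m d \<subseteq> U"
      using \<open>open U\<close> open_contains_ball by blast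
    have "Q i m \<le> 0" if i: "i \<in> Basis" for i
    proof (rule second_derivative_nonpos_at_local_max[OF d(1), where h = "\<lambda>t. u (m + t *\<^sub>R i)"
          and h' = "\<lambda>t. P i (m + t *\<^sub>R i)"])
      fix t :: real assume "\<bar>t\<bar> < d"
      then have t: "m + t *\<^sub>R i \<in> U"
        using d(2) i by (auto simp: dist_norm)
      then show "u (m + t *\<^sub>R i) \<le> u (m + 0 *\<^sub>R i)"
        using m(2) \<open>U \<subseteq> K\<close> by auto
      show "((\<lambda>t. u (m + t *\<^sub>R i)) has_real_derivative P i (m + t *\<^sub>R i)) (at t)"
        using P[OF t i] DERIV_shift[of "\<lambda>t. u (m + t *\<^sub>R i)" _ 0 t]
        by (simp add: scaleR_add_left add_ac)
    qed (use Q[OF \<open>m \<in> U\<close> i] in simp)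
    then show False
      using pos[OF \<open>m \<in> U\<close>] sum_nonpos[of Basis "\<lambda>i. Q i m"] by force
  qed
  then show ?thesis
    using bdry[of m] m \<open>z \<in> K\<close> by force
qed

text \<open>These sums give the Laplacian of the quadratic barrier below: one basis vector is
  vertical and \<open>DIM('a)\<close> are horizontal.\<close>

lemma sum_Basis_fst_snd:
  "(\<Sum>i\<in>(Basis :: ('a::euclidean_space \<times> real) set). (snd i)\<^sup>2) = 1"
  "(\<Sum>i\<in>(Basis :: ('a::euclidean_space \<times> real) set). fst i \<bullet> fst i) = real DIM('a)"
  by (simp_all add: Basis_prod_def sum.union_disjoint sum.reindex inj_on_def
      disjoint_iff zero_not_in_Basis image_iff)

text \<open>The comparison step of Phragmen-Lindelof: a quadratic barrier on a cylinder of radius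
  and height \<open>R\<close> dominates the function. On the axis the barrier is at most linear in
  \<open>y / R\<close>, so a bound \<open>M\<close> that grows more slowly than \<open>R\<close>
  gives a nonpositive limit.\<close>

lemma half_space_box_bound:
  fixes \<psi> :: "'a::euclidean_space \<times> real \<Rightarrow> real" and x\<^sub>0 :: 'a
  assumes cont: "continuous_on {z. 0 \<le> snd z} \<psi>"
    and P: "\<And>z i. 0 < snd z \<Longrightarrow> i \<in> Basis \<Longrightarrow>
      ((\<lambda>t. \<psi> (z + t *\<^sub>R i)) has_real_derivative P i z) (at 0)"
    and Q: "\<And>z i. 0 < snd z \<Longrightarrow> i \<in> Basis \<Longrightarrow>
      ((\<lambda>t. P i (z + t *\<^sub>R i)) has_real_derivative Q i z) (at 0)"
    and subharmonic: "\<And>z. 0 < snd z \<Longrightarrow> (\<Sum>i\<in>Basis. Q i z) \<ge> 0"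
    and zero: "\<And>x. \<psi> (x, 0) \<le> 0"
    and "0 < M" "0 < R"
    and bound: "\<And>x y. dist x\<^sub>0 x \<le> R \<Longrightarrow> 0 \<le> y \<Longrightarrow> y \<le> R \<Longrightarrow> \<psi> (x, y) \<le> M"
    and y: "0 \<le> y" "y \<le> R"
  shows "\<psi> (x\<^sub>0, y) \<le> M * (real DIM('a) + 2) * (y / R)"
proof -
  define n where "n = real DIM('a)"
  have n: "n \<ge> 0" by (simp add: n_def)
  \<comment> \<open>A superharmonic barrier that is at least \<open>M\<close> on the sides and on the top of the box.\<close>
  define a d where "a = M / R\<^sup>2" and "d = M * (n + 2) / R"
  define b :: "'a \<times> real \<Rightarrow> real" where
    "b z = a * ((fst z - x\<^sub>0) \<bullet> (fst z - x\<^sub>0) - (n + 1) * (snd z)\<^sup>2) + d * snd z" for z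
  define b' :: "'a \<times> real \<Rightarrow> 'a \<times> real \<Rightarrow> real" where
    "b' i z = a * (2 * ((fst z - x\<^sub>0) \<bullet> fst i) - (n + 1) * (2 * snd z * snd i)) + d * snd i" for i z
  define b'' :: "'a \<times> real \<Rightarrow> real" where
    "b'' i = 2 * a * (fst i \<bullet> fst i - (n + 1) * (snd i)\<^sup>2)" for i
  have "a > 0"
    using \<open>0 < M\<close> \<open>0 < R\<close> by (simp add: a_def)
  have b': "((\<lambda>t. b (z + t *\<^sub>R i)) has_real_derivative b' i z) (at 0)" for z i
    unfolding b_def b'_def has_field_derivative_def
    by (auto intro!: derivative_eq_intros simp: fun_eq_iff inner_commute algebra_simps power2_eq_square)
  have b'': "((\<lambda>t. b' i (z + t *\<^sub>R i)) has_real_derivative b'' i) (at 0)" for z i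
    unfolding b'_def b''_def has_field_derivative_def
    by (auto intro!: derivative_eq_intros simp: fun_eq_iff inner_commute algebra_simps power2_eq_square)
  \<comment> \<open>The coefficient \<open>n + 1\<close> exceeds the horizontal dimension by one, so
    the Laplacian of \<open>b\<close> is \<open>- 2 * a\<close>: strictly negative, as
    \<open>max_principle\<close> requires of the difference.\<close>
  have "(\<Sum>i\<in>Basis. b'' i) = 2 * a * ((\<Sum>i\<in>(Basis :: ('a \<times> real) set). fst i \<bullet> fst i)
      - (n + 1) * (\<Sum>i\<in>(Basis :: ('a \<times> real) set). (snd i)\<^sup>2))"
    unfolding b''_def by (simp add: sum_subtractf flip: sum_distrib_left)
  then have b''_neg: "(\<Sum>i\<in>Basis. b'' i) < 0"
    unfolding sum_Basis_fst_snd n_def[symmetric] using \<open>0 < a\<close> by simp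
  have "\<psi> (x\<^sub>0, y) - b (x\<^sub>0, y) \<le> 0"
  proof (rule max_principle[where K = "cball x\<^sub>0 R \<times> {0..R}" and U = "ball x\<^sub>0 R \<times> {0<..<R}"
        and u = "\<lambda>z. \<psi> z - b z" and P = "\<lambda>i z. P i z - b' i z" and Q = "\<lambda>i z. Q i z - b'' i"])
    show "compact (cball x\<^sub>0 R \<times> {0..R})"
      by (intro compact_Times) auto
    show "continuous_on (cball x\<^sub>0 R \<times> {0..R}) (\<lambda>z. \<psi> z - b z)"
      unfolding b_def using \<open>0 < R\<close>
      by (intro continuous_intros continuous_on_subset[OF cont]) auto
    show "open (ball x\<^sub>0 R \<times> {0<..<R})"
      by (intro open_Times) auto
    show "(\<Sum>i\<in>Basis. Q i z - b'' i) > 0" if "z \<in> ball x\<^sub>0 R \<times> {0<..<R}" for z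
      using subharmonic[of z] b''_neg that by (auto simp: sum_subtractf)
    show "\<psi> z - b z \<le> 0" if "z \<in> cball x\<^sub>0 R \<times> {0..R} - ball x\<^sub>0 R \<times> {0<..<R}" for z
    proof -
      obtain x s where z: "z = (x, s * R)"
        using \<open>0 < R\<close> by (metis nonzero_eq_divide_eq less_irrefl prod.collapse)
      obtain r where r: "dist x\<^sub>0 x = r * R"
        using \<open>0 < R\<close> by (metis nonzero_eq_divide_eq less_irrefl)
      have rs: "0 \<le> r" "r \<le> 1" "0 \<le> s" "s \<le> 1" "s = 0 \<or> r = 1 \<or> s = 1"
        using that \<open>0 < R\<close> zero_le_dist[of x\<^sub>0 x] unfolding z by (auto simp: r zero_le_mult_iff simp del: zero_le_dist)
      have "(x - x\<^sub>0) \<bullet> (x - x\<^sub>0) = (r * R)\<^sup>2"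
        by (simp add: r[symmetric] dist_norm norm_minus_commute[of x\<^sub>0] power2_norm_eq_inner)
      \<comment> \<open>In the scaled variables \<open>b / M\<close> is \<open>r\<^sup>2\<close> on
        the bottom, \<open>1 + s * ((n + 1) * (1 - s) + 1)\<close> on the side and
        \<open>r\<^sup>2 + 1\<close> on the top. The factor \<open>n + 2\<close> in \<open>d\<close>
        is chosen for the last two values.\<close>
      then have b: "b z = M * (r\<^sup>2 - (n + 1) * s\<^sup>2 + (n + 2) * s)"
        unfolding b_def z a_def d_def using \<open>0 < R\<close> by (simp add: field_simps power_mult_distrib)
      consider "s = 0" | "r = 1" | "s = 1" using rs by blast
      then show ?thesis
      proof cases
        case 1
        have "\<psi> z \<le> 0" "0 \<le> b z"
          using zero[of x] \<open>0 < M\<close> unfolding b by (simp_all add: z 1)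
        then show ?thesis by simp
      next
        case 2
        have "0 \<le> s * ((n + 1) * (1 - s) + 1)"
          using rs n by simp
        then have "M * 1 \<le> b z"
          unfolding b 2 using \<open>0 < M\<close> by (intro mult_left_mono) (auto simp: algebra_simps power2_eq_square)
        then show ?thesis using bound[of x "s * R"] r rs \<open>0 < R\<close> by (simp add: z)
      next
        case 3
        then have "M * 1 \<le> b z"
          unfolding b 3 using \<open>0 < M\<close> by (intro mult_left_mono) auto
        then show ?thesis using bound[of x "s * R"] r rs \<open>0 < R\<close> by (simp add: z)
      qed
    qed
  qed (use P Q b' b'' y \<open>0 < R\<close> in \<open>auto intro!: DERIV_diff\<close>)
  \<comment> \<open>On the axis the horizontal square vanishes and the vertical one has a negative
    sign, so only the linear term is left.\<close>
  moreover have "b (x\<^sub>0, y) \<le> d * y"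
    unfolding b_def using \<open>0 < a\<close> n by (simp add: mult_nonneg_nonpos)
  ultimately show ?thesis
    by (simp add: n_def d_def)
qed

section \<open>Conformal compactifications of the half-space\<close>

lemma has_derivative_imp_line_derivative:
  fixes f :: "'a::real_normed_vector \<Rightarrow> real"
  assumes "(f has_derivative f') (at z)"
  shows "((\<lambda>t. f (z + t *\<^sub>R i)) has_real_derivative f' i) (at 0)"
proof -
  have "((\<lambda>t::real. z + t *\<^sub>R i) has_derivative (\<lambda>t. t *\<^sub>R i)) (at 0)"
    by (auto intro!: derivative_eq_intros)
  then have "((\<lambda>t. f (z + t *\<^sub>R i)) has_derivative (\<lambda>t. f' (t *\<^sub>R i))) (at 0)"
    by (rule has_derivative_compose) (use assms in simp)
  moreover have "(\<lambda>t. f' (t *\<^sub>R i)) = (*) (f' i)"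
    using has_derivative_linear[OF assms] by (auto simp: linear_cmul)
  ultimately show ?thesis
    by (simp add: has_field_derivative_def)
qed

text \<open>The derivatives under the existential quantifier of \<open>C2_on\<close> become
  parameters, so that they can be named in formulas.\<close>

locale C2_half_space =
  fixes \<rho> :: "(real ^ 'n) \<times> real \<Rightarrow> real"
    and \<rho>' :: "(real ^ 'n) \<times> real \<Rightarrow> ((real ^ 'n) \<times> real) \<Rightarrow>\<^sub>L real"
    and \<rho>'' :: "(real ^ 'n) \<times> real \<Rightarrow> ((real ^ 'n) \<times> real) \<Rightarrow>\<^sub>L ((real ^ 'n) \<times> real) \<Rightarrow>\<^sub>L real"
  assumes pos: "z \<in> half_space \<Longrightarrow> 0 < \<rho> z"
    and deriv_within: "z \<in> closed_half_space \<Longrightarrow>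
      (\<rho> has_derivative blinfun_apply (\<rho>' z)) (at z within closed_half_space)"
    and deriv2_within: "z \<in> closed_half_space \<Longrightarrow>
      (\<rho>' has_derivative blinfun_apply (\<rho>'' z)) (at z within closed_half_space)"
begin

lemma continuous: "continuous_on closed_half_space \<rho>"
  by (rule has_derivative_continuous_on) (rule deriv_within)

lemma continuous_deriv: "continuous_on closed_half_space \<rho>'"
  by (rule has_derivative_continuous_on) (rule deriv2_within)

lemma open_half_space: "open (half_space :: ((real ^ 'n) \<times> real) set)"
  unfolding half_space_def by (intro open_Collect_less continuous_intros)

lemma half_space_subset: "(half_space :: ((real ^ 'n) \<times> real) set) \<subseteq> closed_half_space"
  by (auto simp: half_space_def closed_half_space_def)

lemma closure_half_space:
  "closure half_space = (closed_half_space :: ((real ^ 'n) \<times> real) set)"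
proof -
  have "half_space = (UNIV :: (real ^ 'n) set) \<times> {0<..}"
    and *: "closed_half_space = (UNIV :: (real ^ 'n) set) \<times> {0..}"
    by (auto simp: half_space_def closed_half_space_def)
  then show ?thesis
    by (metis closure_Times closure_UNIV closure_greaterThan)
qed

lemma at_within_closed_half_space:
  "z \<in> half_space \<Longrightarrow> at z within closed_half_space = at (z :: (real ^ 'n) \<times> real)"
  by (rule at_within_open_subset[OF _ open_half_space half_space_subset])

lemma deriv: "z \<in> half_space \<Longrightarrow> (\<rho> has_derivative blinfun_apply (\<rho>' z)) (at z)"
  using deriv_within[of z] half_space_subset by (auto simp: at_within_closed_half_space)

lemma deriv2: "z \<in> half_space \<Longrightarrow> (\<rho>' has_derivative blinfun_apply (\<rho>'' z)) (at z)"
  using deriv2_within[of z] half_space_subset by (auto simp: at_within_closed_half_space)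

lemma line_deriv:
  "z \<in> half_space \<Longrightarrow> ((\<lambda>t. \<rho> (z + t *\<^sub>R i)) has_real_derivative \<rho>' z i) (at 0)"
  by (rule has_derivative_imp_line_derivative[OF deriv])

lemma line_deriv2:
  assumes "z \<in> half_space"
  shows "((\<lambda>t. \<rho>' (z + t *\<^sub>R i) j) has_real_derivative \<rho>'' z i j) (at 0)"
  by (rule has_derivative_imp_line_derivative[where f = "\<lambda>w. \<rho>' w j" and f' = "\<lambda>v. \<rho>'' z v j"])
    (rule bounded_linear.has_derivative[OF blinfun.bounded_linear_left deriv2[OF assms]])

lemma vertical_deriv:
  assumes "0 < t"
  shows "((\<lambda>t. \<rho> (x, t)) has_real_derivative \<rho>' (x, t) (0, 1)) (at t)"
  using line_deriv[of "(x, t)" "(0, 1)"] DERIV_shift[of "\<lambda>t. \<rho> (x, t)" _ 0 t] assms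
  by (simp add: half_space_def add.commute)

text \<open>The normalization is a statement about vertical lines, whereas here the boundary point
  is approached in any way. By the mean value theorem the quotient at \<open>(a, y)\<close> is the
  vertical derivative at some \<open>(a, t)\<close> with \<open>0 < t < y\<close>. That point is at
  least as close to \<open>(x, 0)\<close>, and the vertical derivative is continuous up to the
  boundary with value 1 there.\<close>

lemma quotient_tendsto_1:
  assumes "boundary_normalized \<rho>"
  shows "((\<lambda>z. \<rho> z / snd z) \<longlongrightarrow> 1) (at (x, 0) within half_space)"
proof -
  have zero: "\<rho> (x, 0) = 0" and dy: "((\<lambda>y. \<rho> (x, y)) has_real_derivative 1) (at 0 within {0..})" for x
    using assms by (auto simp: boundary_normalized_def)
  \<comment> \<open>Composed with the vertical ray, the total derivative within the closed
    half-space yields a one-sided derivative, which by uniqueness is the prescribed 1.\<close>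
  have pair: "((\<lambda>y. (x, y)) has_derivative (\<lambda>t. (0, t))) (at 0 within {0..})"
    by (auto intro!: derivative_eq_intros)
  have "(\<rho> has_derivative blinfun_apply (\<rho>' (x, 0))) (at (x, 0) within (\<lambda>y. (x, y)) ` {0..})"
    by (rule has_derivative_subset[OF deriv_within]) (auto simp: closed_half_space_def)
  from has_derivative_in_compose[OF pair this]
  have "((\<lambda>y. \<rho> (x, y)) has_derivative (\<lambda>t. \<rho>' (x, 0) (0, t))) (at 0 within {0..})" .
  moreover have "\<rho>' (x, 0) (0, t) = \<rho>' (x, 0) (0, 1) * t" for t :: real
    using blinfun.scaleR_right[of "\<rho>' (x, 0)" t "(0, 1)"] by (simp add: mult.commute)
  then have "(\<lambda>t. \<rho>' (x, 0) (0, t)) = (*) (\<rho>' (x, 0) (0, 1))"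
    by (rule ext)
  ultimately have "((\<lambda>y. \<rho> (x, y)) has_real_derivative \<rho>' (x, 0) (0, 1)) (at 0 within {0..})"
    by (simp add: has_field_derivative_def)
  then have one: "\<rho>' (x, 0) (0, 1) = 1"
    by (rule has_field_derivative_unique[OF _ dy]) (simp add: at_within_Ici_at_right)
  have "(x, 0) \<in> closed_half_space"
    by (simp add: closed_half_space_def)
  then have "(\<rho>' \<longlongrightarrow> \<rho>' (x, 0)) (at (x, 0) within closed_half_space)"
    using continuous_deriv by (simp add: continuous_on_def)
  then have "((\<lambda>z. \<rho>' z (0, 1)) \<longlongrightarrow> \<rho>' (x, 0) (0, 1)) (at (x, 0) within closed_half_space)"
    by (rule blinfun.tendsto) (rule tendsto_const)
  then have lim: "((\<lambda>z. \<rho>' z (0, 1)) \<longlongrightarrow> 1) (at (x, 0) within closed_half_space)"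
    by (simp only: one)
  show ?thesis
  proof (rule Lim_withinI)
    fix e :: real assume "0 < e"
    then obtain d where d: "d > 0" "\<And>z. z \<in> closed_half_space \<Longrightarrow> 0 < dist z (x, 0) \<Longrightarrow>
        dist z (x, 0) < d \<Longrightarrow> dist (\<rho>' z (0, 1)) 1 < e"
      using lim unfolding Lim_within by blast
    have "dist (\<rho> z / snd z) 1 \<le> e" if z: "z \<in> half_space" "dist z (x, 0) < d" for z
    proof -
      obtain a y where a: "z = (a, y)" by (cases z)
      have y: "0 < y" using z by (simp add: a half_space_def)
      have "continuous_on {0..y} (\<lambda>t. \<rho> (a, t))"
        by (rule continuous_on_compose2[OF continuous])
          (auto intro!: continuous_intros simp: closed_half_space_def)
      moreover have "(\<lambda>t. \<rho> (a, t)) differentiable (at t)" if "0 < t" for t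
        using vertical_deriv[OF that] by (auto simp: real_differentiable_def)
      ultimately obtain t l where t: "0 < t" "t < y" "DERIV (\<lambda>t. \<rho> (a, t)) t :> l"
          "\<rho> (a, y) - \<rho> (a, 0) = (y - 0) * l"
        using MVT[OF y, of "\<lambda>t. \<rho> (a, t)"] by blast
      have "l = \<rho>' (a, t) (0, 1)"
        using DERIV_unique[OF t(3) vertical_deriv[OF t(1)]] .
      then have "\<rho> z / snd z = \<rho>' (a, t) (0, 1)"
        using t(4) y zero by (simp add: a field_simps)
      moreover have "dist (a, t) (x, 0) \<le> dist z (x, 0)"
        using power_mono[of t y 2] t by (simp add: a dist_Pair_Pair dist_real_def)
      ultimately show ?thesis
        using d(2)[of "(a, t)"] t z by (simp add: closed_half_space_def)
    qed
    then show "\<exists>d>0. \<forall>z\<in>half_space. 0 < dist z (x, 0) \<and> dist z (x, 0) < d \<longrightarrow> dist (\<rho> z / snd z) 1 \<le> e"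
      using d(1) by blast
  qed
qed

section \<open>Equivalent forms of the boundary condition and of the conclusion\<close>

text \<open>On horizontal vectors the compactified metric is
  \<open>(\<rho> z / snd z)\<^sup>2\<close> times the inner product. One direction is thus
  \<open>quotient_tendsto_1\<close>; for the other, a unit vector and vertical approach give the
  limit of the square, and positivity of \<open>\<rho>\<close> permits the square root.\<close>

lemma boundary_normalized_iff: "boundary_normalized \<rho> \<longleftrightarrow> boundary_metric_euclidean \<rho>"
proof
  assume normalized: "boundary_normalized \<rho>"
  have "((\<lambda>z. (\<rho> z / snd z)\<^sup>2 * (u \<bullet> v)) \<longlongrightarrow> 1\<^sup>2 * (u \<bullet> v)) (at (x, 0) within half_space)"
    for x and u v :: "real ^ 'n"
    by (intro tendsto_mult_right tendsto_power quotient_tendsto_1 normalized)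
  then show "boundary_metric_euclidean \<rho>"
    by (simp add: boundary_metric_euclidean_def compactified_metric_def hyperbolic_metric_def power_divide)
next
  assume euclidean: "boundary_metric_euclidean \<rho>"
  show "boundary_normalized \<rho>"
    unfolding boundary_normalized_def
  proof (intro allI conjI)
    fix x :: "real ^ 'n"
    obtain u :: "real ^ 'n" where u: "u \<bullet> u = 1"
      using nonempty_Basis inner_same_Basis by blast
    have "filterlim (\<lambda>y. (x, y)) (at (x, 0) within half_space) (at_right 0)"
      unfolding filterlim_at
      by (auto intro!: tendsto_Pair simp: half_space_def eventually_at_filter)
    moreover have "((\<lambda>z. compactified_metric \<rho> z (u, 0) (u, 0)) \<longlongrightarrow> u \<bullet> u)
        (at (x, 0) within half_space)"
      using euclidean by (simp add: boundary_metric_euclidean_def)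
    ultimately have "((\<lambda>y. compactified_metric \<rho> (x, y) (u, 0) (u, 0)) \<longlongrightarrow> u \<bullet> u) (at_right 0)"
      by (rule filterlim_compose[rotated])
    then have "((\<lambda>y. sqrt ((\<rho> (x, y) / y)\<^sup>2)) \<longlongrightarrow> sqrt 1) (at_right 0)"
      by (intro tendsto_real_sqrt)
        (simp add: u compactified_metric_def hyperbolic_metric_def power_divide)
    moreover have "\<forall>\<^sub>F y in at_right 0. sqrt ((\<rho> (x, y) / y)\<^sup>2) = \<rho> (x, y) / y"
      using eventually_at_right_less
      by (rule eventually_mono) (use pos in \<open>auto simp: half_space_def less_imp_le\<close>)
    ultimately show lim: "((\<lambda>y. \<rho> (x, y) / y) \<longlongrightarrow> 1) (at_right 0)"
      by (simp add: tendsto_cong)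
    \<comment> \<open>Multiplying back by \<open>y\<close> shows that \<open>\<rho>\<close> tends to
      0, so continuity gives \<open>\<rho> (x, 0) = 0\<close>. The quotient is then the difference
      quotient at 0.\<close>
    have "((\<lambda>y. \<rho> (x, y) / y * y) \<longlongrightarrow> 1 * 0) (at_right 0)"
      by (intro tendsto_mult lim) (rule tendsto_ident_at)
    moreover have "\<forall>\<^sub>F y in at_right 0. \<rho> (x, y) / y * y = \<rho> (x, y)"
      using eventually_at_right_less by (rule eventually_mono) auto
    ultimately have "((\<lambda>y. \<rho> (x, y)) \<longlongrightarrow> 0) (at_right 0)"
      by (simp add: tendsto_cong)
    moreover have "continuous_on {0..} (\<lambda>y. \<rho> (x, y))"
      by (rule continuous_on_compose2[OF continuous])
        (auto intro!: continuous_intros simp: closed_half_space_def)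
    then have "((\<lambda>y. \<rho> (x, y)) \<longlongrightarrow> \<rho> (x, 0)) (at_right 0)"
      by (simp add: continuous_on_def flip: at_within_Ici_at_right)
    ultimately show zero: "\<rho> (x, 0) = 0"
      by (rule tendsto_unique[OF trivial_limit_at_right_real, rotated])
    show "((\<lambda>y. \<rho> (x, y)) has_real_derivative 1) (at 0 within {0..})"
      using lim by (simp add: has_field_derivative_iff zero at_within_Ici_at_right)
  qed
qed

text \<open>Inside, testing the metric on a unit vector gives equal squares of positive numbers. The
  boundary values follow by continuity, since the closed half-space is the closure of the open
  one.\<close>

lemma eq_snd_iff: "(\<forall>z\<in>closed_half_space. \<rho> z = snd z) \<longleftrightarrow>
  (\<forall>z\<in>half_space. \<forall>u v. compactified_metric \<rho> z u v = u \<bullet> v)"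
proof
  assume "\<forall>z\<in>closed_half_space. \<rho> z = snd z"
  then show "\<forall>z\<in>half_space. \<forall>u v. compactified_metric \<rho> z u v = u \<bullet> v"
    by (simp add: compactified_metric_def hyperbolic_metric_def half_space_def closed_half_space_def)
next
  assume metric: "\<forall>z\<in>half_space. \<forall>u v. compactified_metric \<rho> z u v = u \<bullet> v"
  have "\<rho> z - snd z = 0" if z: "z \<in> half_space" for z
  proof -
    have "(\<rho> z)\<^sup>2 = (snd z)\<^sup>2"
      using metric[rule_format, OF z, of "(0, 1)" "(0, 1)"] z
      by (simp add: compactified_metric_def hyperbolic_metric_def half_space_def)
    then have "\<rho> z = snd z"
      by (rule power2_eq_imp_eq) (use pos[OF z] z in \<open>simp_all add: half_space_def\<close>)
    then show ?thesis by simp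
  qed
  moreover have "continuous_on closed_half_space (\<lambda>z. \<rho> z - snd z)"
    by (intro continuous_intros continuous)
  ultimately have "\<rho> z - snd z = 0" if "z \<in> closed_half_space" for z
    using continuous_constant_on_closure[of half_space "\<lambda>z. \<rho> z - snd z" 0 z] that
    by (simp add: closure_half_space)
  then show "\<forall>z\<in>closed_half_space. \<rho> z = snd z" by simp
qed

section \<open>The conformal factor under the curvature and gradient conditions\<close>

definition \<phi> :: "(real ^ 'n) \<times> real \<Rightarrow> real" where
  "\<phi> z = ln (\<rho> z / snd z)"

text \<open>The derivatives of \<open>ln \<rho> - ln y\<close>, term by term, in the index order of
  \<open>conformally_flat\<close>.\<close>

definition d\<phi> :: "(real ^ 'n) \<times> real \<Rightarrow> (real ^ 'n) \<times> real \<Rightarrow> real" where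
  "d\<phi> i z = \<rho>' z i / \<rho> z - snd i / snd z"

definition dd\<phi> :: "(real ^ 'n) \<times> real \<Rightarrow> (real ^ 'n) \<times> real \<Rightarrow> (real ^ 'n) \<times> real \<Rightarrow> real" where
  "dd\<phi> i j z = \<rho>'' z i j / \<rho> z - \<rho>' z i * \<rho>' z j / (\<rho> z)\<^sup>2 + snd i * snd j / (snd z)\<^sup>2"

sublocale conformally_flat half_space "compactified_metric \<rho>" \<phi> d\<phi> dd\<phi>
proof
  show "open (half_space :: ((real ^ 'n) \<times> real) set)" by (rule open_half_space)
next
  fix w :: "(real ^ 'n) \<times> real" and u v
  assume w: "w \<in> half_space"
  have "exp (2 * \<phi> w) = (\<rho> w / snd w)\<^sup>2"
    using pos[OF w] w by (simp add: \<phi>_def exp_double half_space_def)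
  then show "compactified_metric \<rho> w u v = exp (2 * \<phi> w) * (u \<bullet> v)"
    by (simp add: compactified_metric_def hyperbolic_metric_def power_divide)
next
  fix w i :: "(real ^ 'n) \<times> real"
  assume w: "w \<in> half_space"
  note D = line_deriv[OF w, of i]
  have "((\<lambda>t. ln (\<rho> (w + t *\<^sub>R i) / (snd w + t * snd i))) has_real_derivative d\<phi> i w) (at 0)"
    using pos[OF w] w unfolding d\<phi>_def half_space_def
    by (auto intro!: derivative_eq_intros D simp: field_simps)
  then show "((\<lambda>t. \<phi> (w + t *\<^sub>R i)) has_real_derivative d\<phi> i w) (at 0)"
    by (simp add: \<phi>_def)
next
  fix w i j :: "(real ^ 'n) \<times> real"
  assume w: "w \<in> half_space"
  note D = line_deriv[OF w, of i] line_deriv2[OF w, of i j]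
  have "((\<lambda>t. \<rho>' (w + t *\<^sub>R i) j / \<rho> (w + t *\<^sub>R i) - snd j / (snd w + t * snd i))
      has_real_derivative dd\<phi> i j w) (at 0)"
    using pos[OF w] w unfolding dd\<phi>_def half_space_def
    by (auto intro!: derivative_eq_intros D simp: field_simps power2_eq_square)
  then show "((\<lambda>t. d\<phi> j (w + t *\<^sub>R i)) has_real_derivative dd\<phi> i j w) (at 0)"
    by (simp add: d\<phi>_def)
qed

text \<open>Near a boundary point the closed half-space splits into the open one, where
  \<open>quotient_tendsto_1\<close> applies, and the boundary hyperplane, where
  \<open>\<phi>\<close> is constant.\<close>

lemma continuous_\<phi>:
  assumes "boundary_normalized \<rho>"
  shows "continuous_on closed_half_space \<phi>"
  unfolding continuous_on_def
proof
  fix z :: "(real ^ 'n) \<times> real" assume z: "z \<in> closed_half_space"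
  show "(\<phi> \<longlongrightarrow> \<phi> z) (at z within closed_half_space)"
  proof (cases "z \<in> half_space")
    case True
    have "(\<rho> \<longlongrightarrow> \<rho> z) (at z within closed_half_space)"
      using continuous z by (simp add: continuous_on_def)
    then show ?thesis
      unfolding \<phi>_def using True pos[OF True] by (auto intro!: tendsto_intros simp: half_space_def)
  next
    case False
    \<comment> \<open>On the boundary \<open>\<phi>\<close> is \<open>ln (0 / 0) = 0\<close>, the value of its continuous extension.\<close>
    then obtain x where x: "z = (x, 0)"
      using z by (cases z) (auto simp: half_space_def closed_half_space_def)
    have "(\<phi> \<longlongrightarrow> ln 1) (at z within half_space)"
      unfolding \<phi>_def x by (intro tendsto_ln quotient_tendsto_1 assms) simp
    moreover have "(\<phi> \<longlongrightarrow> 0) (at z within {w. snd w = 0})"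
      by (rule tendsto_eventually) (simp add: \<phi>_def eventually_at_filter)
    ultimately have "(\<phi> \<longlongrightarrow> 0) (at z within half_space \<union> {w. snd w = 0})"
      by (simp add: Lim_within_Un)
    moreover have "half_space \<union> {w. snd w = 0} = (closed_half_space :: ((real ^ 'n) \<times> real) set)"
      by (auto simp: half_space_def closed_half_space_def)
    ultimately show ?thesis
      by (simp add: \<phi>_def x)
  qed
qed

text \<open>The dimension is \<open>CARD('n) + 1\<close>. As \<open>CARD('n)\<close> is at least 1,
  the outer factor is positive and the gradient term has a nonnegative coefficient, so the sign
  passes to the Laplacian.\<close>

lemma laplacian_nonpos:
  assumes "z \<in> half_space" and "0 \<le> scalar_curvature (compactified_metric \<rho>) z"
  shows "(\<Sum>i\<in>Basis. dd\<phi> i i z) \<le> 0"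
proof -
  have "0 \<le> - (exp (- 2 * \<phi> z) * (real CARD('n) * (2 * (\<Sum>i\<in>Basis. dd\<phi> i i z)
      + (real CARD('n) - 1) * (\<Sum>i\<in>Basis. (d\<phi> i z)\<^sup>2))))"
    using assms(2) unfolding scalar_curvature[OF assms(1)] by (simp add: mult.assoc)
  then have "2 * (\<Sum>i\<in>Basis. dd\<phi> i i z) + (real CARD('n) - 1) * (\<Sum>i\<in>Basis. (d\<phi> i z)\<^sup>2) \<le> 0"
    by (simp add: mult_le_0_iff)
  moreover have "0 \<le> (real CARD('n) - 1) * (\<Sum>i\<in>Basis. (d\<phi> i z)\<^sup>2)"
    by (intro mult_nonneg_nonneg sum_nonneg) (simp_all add: Suc_le_eq)
  ultimately show ?thesis by linarith
qed

text \<open>Since \<open>exp (- \<phi> z)\<close> is y / \<rho>, the condition bounds the Euclidean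
  gradient by \<rho> / y, and Cauchy-Schwarz turns this into a bound on the logarithmic derivative.
  The direction \<open>v\<close> is kept free because both vertical and horizontal ones are
  used.\<close>

lemma deriv_bound:
  assumes z: "z \<in> half_space"
    and grad: "metric_norm (compactified_metric \<rho>) z (metric_gradient (compactified_metric \<rho>) \<rho> z) \<le> 1"
  shows "\<bar>\<rho>' z v / \<rho> z\<bar> \<le> norm v / snd z"
proof -
  have pos': "0 < \<rho> z" "0 < snd z"
    using pos[OF z] z by (auto simp: half_space_def)
  define G where "G = (\<Sum>i\<in>Basis. \<rho>' z i *\<^sub>R i)"
  have "partial_deriv i \<rho> z = \<rho>' z i" for i
    unfolding partial_deriv_def by (rule DERIV_imp_deriv[OF line_deriv[OF z]])
  then have "exp (- \<phi> z) * norm G \<le> 1"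
    using grad unfolding norm_metric_gradient[OF z] by (simp add: G_def)
  then have G: "norm G \<le> \<rho> z / snd z"
    using pos' by (simp add: \<phi>_def exp_minus field_simps)
  have "\<rho>' z v = \<rho>' z (\<Sum>i\<in>Basis. (v \<bullet> i) *\<^sub>R i)"
    by (simp only: euclidean_representation)
  also have "\<dots> = v \<bullet> G"
    by (simp add: G_def blinfun.sum_right blinfun.scaleR_right inner_sum_right mult.commute
        del: euclidean_representation)
  finally have "\<bar>\<rho>' z v\<bar> \<le> norm v * norm G"
    by (simp add: Cauchy_Schwarz_ineq2)
  also have "\<dots> \<le> norm v * (\<rho> z / snd z)"
    by (intro mult_left_mono G) simp
  finally show ?thesis
    using pos' by (simp add: abs_divide field_simps)
qed

section \<open>Rigidity\<close>

lemma rigidity: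
  assumes normalized: "boundary_normalized \<rho>"
    and curv: "\<forall>z\<in>half_space. 0 \<le> scalar_curvature (compactified_metric \<rho>) z"
    and grad: "\<forall>z\<in>half_space. metric_norm (compactified_metric \<rho>) z
         (metric_gradient (compactified_metric \<rho>) \<rho> z) \<le> 1"
  shows "\<forall>z\<in>closed_half_space. \<rho> z = snd z"
proof -
  have bound: "\<bar>\<rho>' (x, y) v / \<rho> (x, y)\<bar> \<le> norm v / y" if "0 < y" for x y v
    using deriv_bound[of "(x, y)" v] grad that by (simp add: half_space_def)
  have ln_deriv: "((\<lambda>t. ln (\<rho> (x, t))) has_real_derivative \<rho>' (x, t) (0, 1) / \<rho> (x, t)) (at t)"
    and ln_deriv_bound: "\<bar>\<rho>' (x, t) (0, 1) / \<rho> (x, t)\<bar> \<le> 1 / t"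
    if "0 < t" for x t
  proof -
    have "0 < \<rho> (x, t)" using pos that by (simp add: half_space_def)
    then show "((\<lambda>t. ln (\<rho> (x, t))) has_real_derivative \<rho>' (x, t) (0, 1) / \<rho> (x, t)) (at t)"
      using vertical_deriv[OF that] by (auto intro!: derivative_eq_intros)
    show "\<bar>\<rho>' (x, t) (0, 1) / \<rho> (x, t)\<bar> \<le> 1 / t"
      using bound[OF that, of x "(0, 1)"] by simp
  qed
  have \<phi>_eq: "\<phi> (x, t) = ln (\<rho> (x, t)) - ln t" if "0 < t" for x t
    using pos[of "(x, t)"] that by (simp add: \<phi>_def half_space_def ln_div)
  have \<phi>_0: "\<phi> (x, 0) = 0" for x
    by (simp add: \<phi>_def)
  \<comment> \<open>The vertical derivative of \<open>\<phi>\<close> is that of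
    \<open>ln \<rho>\<close> minus 1 / y, hence nonpositive. Derivatives are needed only strictly
    between \<open>s\<close> and \<open>t\<close>, so continuity up to the boundary admits
    \<open>s = 0\<close>.\<close>
  have vertical: "\<phi> (x, t) \<le> \<phi> (x, s)" if "0 \<le> s" "s \<le> t" for x s t
  proof (rule DERIV_nonpos_imp_decreasing_open[OF that(2)])
    show "continuous_on {s..t} (\<lambda>t. \<phi> (x, t))"
      by (rule continuous_on_compose2[OF continuous_\<phi>[OF normalized]])
        (use that in \<open>auto simp: closed_half_space_def intro!: continuous_intros\<close>)
    fix r assume r: "s < r" "r < t"
    then have "0 < r" using that by simp
    have "((\<lambda>t. \<phi> (x, t)) has_real_derivative \<rho>' (x, r) (0, 1) / \<rho> (x, r) - 1 / r) (at r)"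
      by (rule has_field_derivative_transform_within_open[where S = "{0<..}",
            OF DERIV_diff[OF ln_deriv[OF \<open>0 < r\<close>] DERIV_ln_divide[OF \<open>0 < r\<close>]]])
        (use \<phi>_eq \<open>0 < r\<close> in auto)
    then show "\<exists>y. ((\<lambda>t. \<phi> (x, t)) has_real_derivative y) (at r) \<and> y \<le> 0"
      using ln_deriv_bound[OF \<open>0 < r\<close>, of x] by (intro exI conjI) (assumption, linarith)
  qed
  have "\<phi> (x\<^sub>0, y) = 0" if y: "0 < y" for x\<^sub>0 y
  proof -
    \<comment> \<open>One \<open>ln R\<close> comes from \<phi> = ln \<rho> - ln y at height
      \<open>R\<close>, the other from climbing from height 1 to \<open>R\<close>; the 1 pays for
      the horizontal segment. The absolute value keeps \<open>M R\<close> positive.\<close>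
    define M where "M R = 2 * ln R + 1 + \<bar>ln (\<rho> (x\<^sub>0, 1))\<bar>" for R
    have growth: "- \<phi> (x, t) \<le> M R" if R: "1 \<le> R" and x: "dist x\<^sub>0 x \<le> R" and t: "0 \<le> t" "t \<le> R" for R x t
    proof -
      \<comment> \<open>The logarithmic derivative is at least -1 / r, so
        \<open>ln \<rho> + ln y\<close> is nondecreasing along the vertical line.\<close>
      have "ln (\<rho> (x\<^sub>0, 1)) + ln 1 \<le> ln (\<rho> (x\<^sub>0, R)) + ln R"
      proof (rule DERIV_nonneg_imp_nondecreasing[OF R])
        fix r :: real assume "1 \<le> r"
        then have r: "0 < r" by simp
        show "\<exists>y. ((\<lambda>t. ln (\<rho> (x\<^sub>0, t)) + ln t) has_real_derivative y) (at r) \<and> 0 \<le> y"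
          by (intro exI conjI, rule DERIV_add[OF ln_deriv[OF r] DERIV_ln_divide[OF r]])
            (use ln_deriv_bound[OF r, of x\<^sub>0] in linarith)
      qed
      \<comment> \<open>Along the segment at height \<open>R\<close> from \<open>(x, R)\<close> to
        \<open>(x\<^sub>0, R)\<close>, the derivative of \<open>ln \<rho>\<close> is at most length
        over height, and the length is at most \<open>R\<close>.\<close>
      moreover have "ln (\<rho> (x\<^sub>0, R)) - ln (\<rho> (x, R)) \<le> 1"
      proof -
        define h where "h s = ln (\<rho> ((x, R) + s *\<^sub>R (x\<^sub>0 - x, 0)))" for s
        define h' where "h' s = \<rho>' (x + s *\<^sub>R (x\<^sub>0 - x), R) (x\<^sub>0 - x, 0) / \<rho> (x + s *\<^sub>R (x\<^sub>0 - x), R)" for s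
        have h': "(h has_real_derivative h' s) (at s)" for s
        proof -
          have in_hs: "(x, R) + s *\<^sub>R (x\<^sub>0 - x, 0) \<in> half_space"
            using R by (simp add: half_space_def)
          have "((\<lambda>s. \<rho> ((x, R) + s *\<^sub>R (x\<^sub>0 - x, 0))) has_real_derivative
              \<rho>' ((x, R) + s *\<^sub>R (x\<^sub>0 - x, 0)) (x\<^sub>0 - x, 0)) (at s)"
            using line_deriv[OF in_hs, of "(x\<^sub>0 - x, 0)"]
              DERIV_shift[of "\<lambda>s. \<rho> ((x, R) + s *\<^sub>R (x\<^sub>0 - x, 0))" _ 0 s]
            by (simp add: algebra_simps)
          from DERIV_chain2[OF DERIV_ln_divide[OF pos[OF in_hs]] this] show ?thesis
            by (simp add: h_def[abs_def] h'_def)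
        qed
        obtain s where "h 1 - h 0 = (1 - 0) * h' s"
          using MVT2[of 0 1 h h'] h' by auto
        also have "\<dots> \<le> norm (x\<^sub>0 - x, 0 :: real) / R"
          using bound[of R "x + s *\<^sub>R (x\<^sub>0 - x)" "(x\<^sub>0 - x, 0)"] R
          by (simp add: h'_def abs_le_iff del: abs_divide)
        also have "\<dots> \<le> 1"
          using x R by (simp add: dist_norm norm_Pair)
        finally show ?thesis
          by (simp add: h_def)
      qed
      \<comment> \<open>By monotonicity the worst value of \<open>- \<phi>\<close> on a vertical
        segment is at its top, so height \<open>R\<close> suffices.\<close>
      moreover have "\<phi> (x, R) \<le> \<phi> (x, t)"
        using vertical t by blast
      ultimately show ?thesis
        using \<phi>_eq[of R x] R by (simp add: M_def)
    qed
    \<comment> \<open>The box bound is applied to the subharmonic function \<open>- \<phi>\<close>;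
      \<open>1 \<le> R\<close> is there for the growth estimate, \<open>y \<le> R\<close> to have
      the point in the box.\<close>
    have "- \<phi> (x\<^sub>0, y) \<le> M R * (real CARD('n) + 2) * (y / R)" if R: "1 \<le> R" "y \<le> R" for R
    proof -
      have "0 < M R" using ln_ge_zero[OF R(1)] unfolding M_def by linarith
      have "- \<phi> (x\<^sub>0, y) \<le> M R * (real DIM(real ^ 'n) + 2) * (y / R)"
      proof (rule half_space_box_bound[where P = "\<lambda>i z. - d\<phi> i z" and Q = "\<lambda>i z. - dd\<phi> i i z"])
        show "continuous_on {z. 0 \<le> snd z} (\<lambda>z. - \<phi> z)"
          using continuous_\<phi>[OF normalized] by (simp add: closed_half_space_def continuous_on_minus)
        show "((\<lambda>t. - \<phi> (z + t *\<^sub>R i)) has_real_derivative - d\<phi> i z) (at 0)"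
          if "0 < snd z" "i \<in> Basis" for z i
          by (intro DERIV_minus partial) (use that in \<open>auto simp: half_space_def\<close>)
        show "((\<lambda>t. - d\<phi> i (z + t *\<^sub>R i)) has_real_derivative - dd\<phi> i i z) (at 0)"
          if "0 < snd z" "i \<in> Basis" for z i
          by (intro DERIV_minus partial2) (use that in \<open>auto simp: half_space_def\<close>)
        show "0 \<le> (\<Sum>i\<in>Basis. - dd\<phi> i i z)" if "0 < snd z" for z
          using laplacian_nonpos[of z] curv that by (simp add: half_space_def sum_negf)
      qed (use growth R y \<open>0 < M R\<close> \<phi>_0 in auto)
      then show ?thesis by simp
    qed
    then have "\<forall>\<^sub>F R in at_top. - \<phi> (x\<^sub>0, y) \<le> M R * (real CARD('n) + 2) * (y / R)"
      unfolding eventually_at_top_linorder by (intro exI[of _ "max 1 y"]) auto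
    \<comment> \<open>\<open>M R\<close> grows like \<open>2 * ln R\<close>, so division by
      \<open>R\<close> sends the bound to 0 while the left-hand side does not depend on
      \<open>R\<close>.\<close>
    moreover have "((\<lambda>R. M R * (real CARD('n) + 2) * (y / R)) \<longlongrightarrow> 0) at_top"
      unfolding M_def by real_asymp
    ultimately have "- \<phi> (x\<^sub>0, y) \<le> 0"
      by (intro tendsto_lowerbound) auto
    moreover have "\<phi> (x\<^sub>0, y) \<le> 0"
      using vertical[of 0 y x\<^sub>0] y \<phi>_0 by simp
    ultimately show ?thesis by simp
  qed
  then have "ln (\<rho> (x, y)) = ln y" if "0 < y" for x y
    using \<phi>_eq[OF that, of x] that by simp
  then have "\<rho> (x, y) = y" if "0 < y" for x y
    using ln_inj_iff[of "\<rho> (x, y)" y] pos[of "(x, y)"] that by (simp add: half_space_def)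
  moreover have "\<rho> (x, 0) = 0" for x
    using normalized by (simp add: boundary_normalized_def)
  ultimately have "\<rho> (x, y) = y" if "0 \<le> y" for x y
    using that by (cases "y = 0") auto
  then show ?thesis
    by (auto simp: closed_half_space_def)
qed

end

text \<open>The two equivalences stand beside the implication, so that either wording of the
  boundary condition and of the conclusion may be substituted in it.\<close>

theorem theorem1p4:
  fixes \<rho> :: "(real ^ 'n) \<times> real \<Rightarrow> real"
  assumes pos: "\<forall>z\<in>half_space. 0 < \<rho> z"
    and C2: "C2_on \<rho> closed_half_space"
  shows "(boundary_normalized \<rho> \<longleftrightarrow> boundary_metric_euclidean \<rho>) \<and>
    ((\<forall>z\<in>closed_half_space. \<rho> z = snd z) \<longleftrightarrow>
       (\<forall>z\<in>half_space. \<forall>u v. compactified_metric \<rho> z u v = u \<bullet> v)) \<and>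
    (boundary_normalized \<rho> \<and>
     (\<forall>z\<in>half_space. 0 \<le> scalar_curvature (compactified_metric \<rho>) z) \<and>
     (\<forall>z\<in>half_space. metric_norm (compactified_metric \<rho>) z
         (metric_gradient (compactified_metric \<rho>) \<rho> z) \<le> 1)
     \<longrightarrow> (\<forall>z\<in>closed_half_space. \<rho> z = snd z))"
proof -
  obtain \<rho>' \<rho>'' where "C2_half_space \<rho> \<rho>' \<rho>''"
    using pos C2 unfolding C2_on_def C2_half_space_def by blast
  then interpret C2_half_space \<rho> \<rho>' \<rho>'' .
  show ?thesis
    using boundary_normalized_iff eq_snd_iff rigidity by blast
qed

end
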